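(* Let $k > \ell \geq 1$ be integers. There exists a coloring $c : \omega \to k$ such that for every stable coloring $d : [\omega]^2 \to \ell$ (whether or not $d$ is computable from $c$), there is an infinite set $H$ homogeneous for $d$ such that $H$ computes no infinite set homogeneous for $c$.
   Context: For an infinite set $X$ and $n\geq1$, $[X]^n$ is the set of tuples $\langle x_0,\dots,x_{n-1}\rangle$ with $x_0<\dots<x_{n-1}$ all in $X$; a $k$-coloring of $[X]^n$ is a map $[X]^n\to\{0,\dots,k-1\}$. A set $Y$ is homogeneous for a coloring $c:[\omega]^n\to k$ if $c$ is constant on $[Y]^n$. A coloring $d:[\omega]^2\to\ell$ is stable if for every $x$ there are $s>x$ and $i<\ell$ with $d(x,y)=i$ for all $y\geq s$. *)

theory Defs
  imports Main
begin

definition tuples :: "nat set \<Rightarrow> nat \<Rightarrow> nat list set" where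
  "tuples X n = {xs. length xs = n \<and> sorted_wrt (<) xs \<and> set xs \<subseteq> X}"

text \<open>Only the values of a coloring on increasing tuples matter; it is unconstrained elsewhere.\<close>

definition coloring :: "nat set \<Rightarrow> nat \<Rightarrow> nat \<Rightarrow> (nat list \<Rightarrow> nat) \<Rightarrow> bool" where
  "coloring X n k c \<longleftrightarrow> (\<forall>xs \<in> tuples X n. c xs < k)"

definition homogeneous :: "nat \<Rightarrow> (nat list \<Rightarrow> nat) \<Rightarrow> nat set \<Rightarrow> bool" where
  "homogeneous n c Y \<longleftrightarrow> (\<exists>i. \<forall>xs \<in> tuples Y n. c xs = i)"

definition stable_coloring :: "nat \<Rightarrow> (nat list \<Rightarrow> nat) \<Rightarrow> bool" where
  "stable_coloring l d \<longleftrightarrow> (\<forall>x. \<exists>s > x. \<exists>i < l. \<forall>y \<ge> s. d [x, y] = i)"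

text \<open>The usual identification of a map on numbers with a map on tuples of length one.\<close>

definition on_singletons :: "(nat \<Rightarrow> nat) \<Rightarrow> nat list \<Rightarrow> nat" where
  "on_singletons c xs = c (hd xs)"

text \<open>
  Kleene's partial recursive functions relative to a set: \<open>evals A p xs y\<close> says that the
  program \<open>p\<close> with access to \<open>A\<close> halts on input \<open>xs\<close> with output \<open>y\<close>. Programs carry no arity;
  one applied to an input list of unsuitable length simply has no value.
\<close>

datatype prog =
    Zero
  | Succ
  | Proj nat
  | Query
  | Comp prog "prog list"
  | Prec prog prog
  | Mu prog

inductive evals :: "nat set \<Rightarrow> prog \<Rightarrow> nat list \<Rightarrow> nat \<Rightarrow> bool" for A :: "nat set" where
  zero: "evals A Zero xs 0"
| succ: "evals A Succ [x] (Suc x)"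
| proj: "i < length xs \<Longrightarrow> evals A (Proj i) xs (xs ! i)"
| query: "evals A Query [x] (if x \<in> A then 1 else 0)"
| comp: "list_all2 (\<lambda>q y. evals A q xs y) qs ys \<Longrightarrow> evals A p ys z \<Longrightarrow> evals A (Comp p qs) xs z"
| prec_0: "evals A p xs y \<Longrightarrow> evals A (Prec p q) (0 # xs) y"
| prec_Suc: "evals A (Prec p q) (n # xs) y \<Longrightarrow> evals A q (n # y # xs) z \<Longrightarrow>
    evals A (Prec p q) (Suc n # xs) z"
| mu: "evals A p (n # xs) 0 \<Longrightarrow> (\<And>m. m < n \<Longrightarrow> \<exists>y > 0. evals A p (m # xs) y) \<Longrightarrow>
    evals A (Mu p) xs n"

definition computes :: "nat set \<Rightarrow> nat set \<Rightarrow> bool" where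
  "computes A B \<longleftrightarrow> (\<exists>p. \<forall>x. evals A p [x] (if x \<in> B then 1 else 0))"

end

theory Submission
  imports Defs "HOL-Analysis.Finite_Cartesian_Product"
begin

text \<open>
  The only facts about Turing functionals that matter are that there are countably many of them and
  that each computation uses finitely many oracle bits. The coloring \<open>c\<close> is chosen generic over a
  countable family \<open>M\<close> of infinite sets, the reservoirs, closed under a few operations.

  Given \<open>d\<close>, let \<open>B\<^sub>i\<close> be the set of points of limit color \<open>i\<close>, and pick a least set \<open>I\<close> of colors
  such that some reservoir is covered by the \<open>B\<^sub>i\<close> with \<open>i \<in> I\<close>; every reservoir inside it then
  meets each of these \<open>B\<^sub>i\<close> infinitely often. Mathias forcing with one stem per \<open>i \<in> I\<close> builds
  homogeneous sets \<open>H\<^sub>i\<close>, and it suffices to defeat every family of guesses, one pair of a functional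
  and a color \<open>j\<^sub>i\<close> of \<open>c\<close> per \<open>i\<close>, for at least one \<open>i\<close>; as \<open>l < k\<close>, some color \<open>j\<close> differs from all
  \<open>j\<^sub>i\<close>. For each \<open>i\<close> consider the tree of increasing sequences of elements of the reservoir on which
  the functional has not yet enumerated a number beyond the first element. An infinite path is a
  reservoir that makes the functional enumerate a finite set. Otherwise the tree is well-founded,
  and this allows one to descend in it along \<open>B\<^sub>i\<close>, each time beyond the point where \<open>d\<close> has
  stabilised on the elements chosen before. A node is labelled \<open>x\<close> if
  infinitely many children are, starting from the leaves that enumerate \<open>x\<close>; the root has no label,
  so one reaches an unlabelled node with infinitely many labelled children, whose labels then form a
  finite-to-one function of the child. Doing this for all \<open>i\<close> in turn, within ever smaller
  reservoirs, leaves a reservoir with one finite-to-one function per \<open>i\<close>. By genericity there is a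
  \<open>y\<close> in it at which all these functions take values of color \<open>j\<close>; this \<open>y\<close> is in some \<open>B\<^sub>i\<close>, and
  the tree for this \<open>i\<close> yields the extension of the stem.
\<close>

section \<open>Oracle computations\<close>

instance prog :: countable
  by countable_datatype

lemma evals_deterministic:
  assumes "evals A p xs y" "evals A p xs z"
  shows "y = z"
  using assms
proof (induction arbitrary: z rule: evals.induct)
  case (comp xs qs ys p w)
  from comp.prems obtain ys' where ys': "list_all2 (\<lambda>q y. evals A q xs y) qs ys'" "evals A p ys' z"
    by (cases rule: evals.cases) auto
  have "ys = ys'"
    using comp.IH(1) ys'(1) by (auto simp: list_all2_conv_all_nth intro!: nth_equalityI)
  then show ?case using comp.IH(2) ys'(2) by blast
next
  case (prec_Suc p q n xs y w)
  from prec_Suc.prems show ?case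
    by (cases rule: evals.cases) (use prec_Suc.IH in blast)
next
  case (mu p n xs)
  from mu.prems have z: "evals A p (z # xs) 0" "\<And>m. m < z \<Longrightarrow> \<exists>y>0. evals A p (m # xs) y"
    by (cases rule: evals.cases; auto)+
  have "\<not> z < n" using mu.IH(2) z(1) by fastforce
  moreover have "\<not> n < z" using mu.IH(1) z(2) by fastforce
  ultimately show ?case by simp
next
  case (prec_0 p xs y q)
  from prec_0.prems show ?case by (cases rule: evals.cases) (use prec_0.IH in simp)
qed (erule evals.cases; simp)+

text \<open>A functional is kept only as the relation \<open>\<Phi> A x\<close>, read as: with
  oracle \<open>A\<close> it enumerates \<open>x\<close>. The condition is the use
  principle.\<close>

definition finite_use :: "(nat set \<Rightarrow> nat \<Rightarrow> bool) \<Rightarrow> bool" where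
  "finite_use \<Phi> \<longleftrightarrow> (\<forall>A x. \<Phi> A x \<longrightarrow> (\<exists>u. \<forall>B. B \<inter> {..<u} = A \<inter> {..<u} \<longrightarrow> \<Phi> B x))"

lemma agree_below_mono:
  fixes u v :: nat
  assumes "B \<inter> {..<v} = A \<inter> {..<v}" "u \<le> v"
  shows "B \<inter> {..<u} = A \<inter> {..<u}"
proof -
  have "{..<u} = {..<v} \<inter> {..<u}" using assms(2) by auto
  then show ?thesis using assms(1) by (metis Int_assoc)
qed

lemma bounded_choice:
  fixes Q :: "nat \<Rightarrow> nat \<Rightarrow> bool"
  assumes "\<And>m. m < n \<Longrightarrow> \<exists>u. Q m u" and "\<And>m u v. Q m u \<Longrightarrow> u \<le> v \<Longrightarrow> Q m v"
  shows "\<exists>u. \<forall>m<n. Q m u"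
proof -
  obtain f where f: "\<And>m. m < n \<Longrightarrow> Q m (f m)" using assms(1) by metis
  have "Q m (Max (f ` {..<n}))" if "m < n" for m
    using that by (intro assms(2)[OF f]) auto
  then show ?thesis by blast
qed

text \<open>Each instance of a rule has finitely many premises, so the maximum of their use bounds
  serves. For \<open>Comp\<close> and \<open>Mu\<close>, where the number of premises varies,
  \<open>bounded_choice\<close> merges the bounds.\<close>

lemma evals_finite_use:
  assumes "evals A p xs y"
  shows "\<exists>u. \<forall>B. B \<inter> {..<u} = A \<inter> {..<u} \<longrightarrow> evals B p xs y"
  using assms
proof (induction rule: evals.induct)
  case (query x)
  have "evals B Query [x] (if x \<in> A then 1 else 0)"
    if "B \<inter> {..<Suc x} = A \<inter> {..<Suc x}" for B
  proof -
    have "x \<in> A \<longleftrightarrow> x \<in> B" using that by blast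
    then show ?thesis using evals.query[of B x] by simp
  qed
  then show ?case by meson
next
  case (comp xs qs ys p z)
  have "\<exists>u. \<forall>m<length qs. \<forall>B. B \<inter> {..<u} = A \<inter> {..<u} \<longrightarrow> evals B (qs ! m) xs (ys ! m)"
  proof (rule bounded_choice)
    fix m assume "m < length qs"
    then show "\<exists>u. \<forall>B. B \<inter> {..<u} = A \<inter> {..<u} \<longrightarrow> evals B (qs ! m) xs (ys ! m)"
      using comp.IH(1) by (auto simp: list_all2_conv_all_nth)
  qed (metis agree_below_mono)
  then obtain u where u:
    "\<And>B m. m < length qs \<Longrightarrow> B \<inter> {..<u} = A \<inter> {..<u} \<Longrightarrow> evals B (qs ! m) xs (ys ! m)"
    by meson
  obtain v where v: "\<And>B. B \<inter> {..<v} = A \<inter> {..<v} \<Longrightarrow> evals B p ys z" using comp.IH(2) by meson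
  have "evals B (Comp p qs) xs z" if "B \<inter> {..<max u v} = A \<inter> {..<max u v}" for B
  proof (rule evals.comp)
    show "list_all2 (\<lambda>q y. evals B q xs y) qs ys"
      using comp.IH(1) u agree_below_mono[OF that, of u] by (auto simp: list_all2_conv_all_nth)
    show "evals B p ys z" using v agree_below_mono[OF that, of v] by simp
  qed
  then show ?case by meson
next
  case (prec_0 p xs y q)
  then show ?case by (meson evals.prec_0)
next
  case (prec_Suc p q n xs y z)
  then obtain u v where "\<And>B. B \<inter> {..<u} = A \<inter> {..<u} \<Longrightarrow> evals B (Prec p q) (n # xs) y"
    "\<And>B. B \<inter> {..<v} = A \<inter> {..<v} \<Longrightarrow> evals B q (n # y # xs) z" by meson
  then have "evals B (Prec p q) (Suc n # xs) z" if "B \<inter> {..<max u v} = A \<inter> {..<max u v}" for B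
    using agree_below_mono[OF that, of u] agree_below_mono[OF that, of v]
    by (intro evals.prec_Suc[of _ _ _ _ _ y]) simp_all
  then show ?case by meson
next
  case (mu p n xs)
  have "\<exists>u. \<forall>m<n. \<forall>B. B \<inter> {..<u} = A \<inter> {..<u} \<longrightarrow> (\<exists>y>0. evals B p (m # xs) y)"
  proof (rule bounded_choice)
    fix m assume "m < n"
    then show "\<exists>u. \<forall>B. B \<inter> {..<u} = A \<inter> {..<u} \<longrightarrow> (\<exists>y>0. evals B p (m # xs) y)"
      using mu.IH(2) by meson
  qed (metis agree_below_mono)
  then obtain u where u:
    "\<And>B m. m < n \<Longrightarrow> B \<inter> {..<u} = A \<inter> {..<u} \<Longrightarrow> \<exists>y>0. evals B p (m # xs) y"
    by meson
  obtain v where v: "\<And>B. B \<inter> {..<v} = A \<inter> {..<v} \<Longrightarrow> evals B p (n # xs) 0" using mu.IH(1) by meson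
  have "evals B (Mu p) xs n" if "B \<inter> {..<max u v} = A \<inter> {..<max u v}" for B
    using u v agree_below_mono[OF that, of u] agree_below_mono[OF that, of v]
    by (intro evals.mu) simp_all
  then show ?case by meson
qed (auto intro: evals.intros)

section \<open>Labelled trees of finite sets\<close>

text \<open>A node of the tree is the finite set \<open>A\<close> of the entries of an increasing sequence.\<close>

definition hit :: "nat set \<Rightarrow> (nat set \<Rightarrow> nat \<Rightarrow> bool) \<Rightarrow> nat set \<Rightarrow> nat \<Rightarrow> bool" where
  "hit F \<Phi> A x \<longleftrightarrow> (\<exists>a\<in>A. a < x) \<and>
    (\<exists>E\<subseteq>A. \<forall>H. F \<union> E \<subseteq> H \<and> (\<forall>h\<in>H - (F \<union> E). \<forall>a\<in>A. a < h) \<longrightarrow> \<Phi> H x)"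

text \<open>For infinite \<open>Y\<close> this says that \<open>Y\<close> is an infinite path; by
  \<open>hit_mono\<close>, finite subsets can stand in for initial segments.\<close>

definition unhit :: "nat set \<Rightarrow> (nat set \<Rightarrow> nat \<Rightarrow> bool) \<Rightarrow> nat set \<Rightarrow> bool" where
  "unhit F \<Phi> Y \<longleftrightarrow> (\<forall>A\<subseteq>Y. finite A \<longrightarrow> (\<forall>x. \<not> hit F \<Phi> A x))"

text \<open>The last premise of \<open>node\<close> turns hit nodes into genuine leaves: a label not
  hit at its own node is inherited only if that node is unhit, so a descent along labels stays
  inside \<open>unhit_tree\<close>. A node may carry several labels.\<close>

inductive label :: "nat set \<Rightarrow> nat set \<Rightarrow> (nat set \<Rightarrow> nat \<Rightarrow> bool) \<Rightarrow> nat set \<Rightarrow> nat \<Rightarrow> bool"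
  for X F \<Phi> where
  leaf: "hit F \<Phi> A x \<Longrightarrow> label X F \<Phi> A x"
| node: "infinite S \<Longrightarrow> S \<subseteq> X \<Longrightarrow> (\<And>y. y \<in> S \<Longrightarrow> \<forall>a\<in>A. a < y) \<Longrightarrow>
    (\<And>y. y \<in> S \<Longrightarrow> label X F \<Phi> (insert y A) x) \<Longrightarrow> (\<And>z. \<not> hit F \<Phi> A z) \<Longrightarrow> label X F \<Phi> A x"

definition children :: "nat set \<Rightarrow> nat set \<Rightarrow> (nat set \<Rightarrow> nat \<Rightarrow> bool) \<Rightarrow> nat set \<Rightarrow> nat set \<Rightarrow> nat set" where
  "children X F \<Phi> A Z = {y \<in> X. (\<forall>a\<in>A. a < y) \<and> (\<exists>x\<in>Z. label X F \<Phi> (insert y A) x)}"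

definition child_label :: "nat set \<Rightarrow> nat set \<Rightarrow> (nat set \<Rightarrow> nat \<Rightarrow> bool) \<Rightarrow> nat set \<Rightarrow> nat \<Rightarrow> nat" where
  "child_label X F \<Phi> A y = (SOME x. label X F \<Phi> (insert y A) x)"

lemma hit_mono: "hit F \<Phi> A x \<Longrightarrow> A \<subseteq> A' \<Longrightarrow> hit F \<Phi> A' x"
  unfolding hit_def
proof (elim conjE exE, intro conjI)
  fix E assume "A \<subseteq> A'" "E \<subseteq> A"
    and E: "\<forall>H. F \<union> E \<subseteq> H \<and> (\<forall>h\<in>H - (F \<union> E). \<forall>a\<in>A. a < h) \<longrightarrow> \<Phi> H x"
  then show "\<exists>E\<subseteq>A'. \<forall>H. F \<union> E \<subseteq> H \<and> (\<forall>h\<in>H - (F \<union> E). \<forall>a\<in>A'. a < h) \<longrightarrow> \<Phi> H x"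
    by (intro exI[of _ E] conjI allI impI) (blast, metis subsetD)
qed blast

text \<open>Let \<open>b\<close> be any element of \<open>Y\<close>. If some \<open>x > b\<close>
  were enumerated, an initial segment of \<open>Y\<close> reaching beyond both \<open>b\<close> and
  the use would hit \<open>x\<close>.\<close>

lemma finite_if_unhit:
  assumes "finite_use \<Phi>" "infinite Y" "unhit F \<Phi> Y" "F \<subseteq> H" "H \<subseteq> F \<union> Y"
  shows "finite {x. \<Phi> H x}"
proof -
  obtain b where b: "b \<in> Y" using assms(2) by fastforce
  have "\<not> \<Phi> H x" if "b < x" for x
  proof
    assume "\<Phi> H x"
    then obtain u where u: "\<And>B. B \<inter> {..<u} = H \<inter> {..<u} \<Longrightarrow> \<Phi> B x"
      using assms(1) unfolding finite_use_def by blast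
    obtain m where m: "m \<in> Y" "m \<ge> u" using assms(2) infinite_nat_iff_unbounded_le by blast
    \<comment> \<open>\<open>b\<close> belongs to \<open>A\<close> so that \<open>x\<close> exceeds
      an element, \<open>m\<close> so that oracles prolonged above \<open>A\<close> agree with
      \<open>H\<close> below \<open>u\<close>.\<close>
    define A where "A = Y \<inter> {..max b m}"
    have "\<Phi> H' x" if H': "F \<union> (H \<inter> A) \<subseteq> H'" "\<forall>h\<in>H' - (F \<union> (H \<inter> A)). \<forall>a\<in>A. a < h" for H'
    proof (rule u, intro set_eqI iffI)
      fix h assume h: "h \<in> H' \<inter> {..<u}"
      then have "\<not> m < h" using m by simp
      moreover have "m \<in> A" using m by (simp add: A_def)
      ultimately have "h \<in> F \<union> (H \<inter> A)" using H'(2) h by blast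
      then show "h \<in> H \<inter> {..<u}" using h assms(4) by blast
    next
      fix h assume h: "h \<in> H \<inter> {..<u}"
      then have "h \<in> F \<union> (H \<inter> A)" using m assms(5) by (auto simp: A_def)
      then show "h \<in> H' \<inter> {..<u}" using H'(1) h by blast
    qed
    then have "\<exists>E\<subseteq>A. \<forall>H'. F \<union> E \<subseteq> H' \<and> (\<forall>h\<in>H' - (F \<union> E). \<forall>a\<in>A. a < h) \<longrightarrow> \<Phi> H' x"
      by (meson Int_lower2)
    moreover have "b \<in> A" using b by (simp add: A_def)
    ultimately have "hit F \<Phi> A x" unfolding hit_def using that by blast
    moreover have "A \<subseteq> Y" "finite A" by (auto simp: A_def)
    ultimately show False using assms(3) unfolding unhit_def by blast
  qed
  then have "{x. \<Phi> H x} \<subseteq> {..b}" by (auto simp: not_less[symmetric])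
  then show ?thesis using finite_subset by blast
qed

section \<open>Well-founded trees and their labels\<close>

definition unhit_tree :: "nat set \<Rightarrow> nat set \<Rightarrow> (nat set \<Rightarrow> nat \<Rightarrow> bool) \<Rightarrow> (nat set \<times> nat set) set" where
  "unhit_tree X F \<Phi> = {(insert y A, A) | y A.
    finite A \<and> A \<subseteq> X \<and> y \<in> X \<and> (\<forall>a\<in>A. a < y) \<and> (\<forall>x. \<not> hit F \<Phi> A x)}"

text \<open>Nodes grow strictly along an infinite branch. Their union is infinite, and each finite
  subset of it lies in one of these unhit nodes, so the union is unhit.\<close>

lemma wf_unhit_tree:
  assumes "\<And>Y. Y \<subseteq> X \<Longrightarrow> infinite Y \<Longrightarrow> \<not> unhit F \<Phi> Y"
  shows "wf (unhit_tree X F \<Phi>)"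
  unfolding wf_iff_no_infinite_down_chain
proof
  assume "\<exists>f. \<forall>n. (f (Suc n), f n) \<in> unhit_tree X F \<Phi>"
  then obtain f where f: "\<And>n. (f (Suc n), f n) \<in> unhit_tree X F \<Phi>" by blast
  have sub: "f n \<subseteq> X" "finite (f n)" "\<And>x. \<not> hit F \<Phi> (f n) x" "f n \<subset> f (Suc n)" for n
    using f[of n] unfolding unhit_tree_def by auto
  define Y where "Y = (\<Union>n. f n)"
  have mono: "f m \<subseteq> f n" if "m \<le> n" for m n
    using lift_Suc_mono_le[of f, OF _ that] sub(4) by blast
  have "infinite Y"
  proof
    assume "finite Y"
    have "n \<le> card (f n)" for n
    proof (induction n)
      case (Suc n)
      have "card (f n) < card (f (Suc n))" using sub by (intro psubset_card_mono)
      then show ?case using Suc by simp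
    qed simp
    moreover have "card (f (Suc (card Y))) \<le> card Y"
      by (rule card_mono[OF \<open>finite Y\<close>]) (auto simp: Y_def)
    ultimately show False by (metis Suc_n_not_le_n order_trans)
  qed
  moreover have "Y \<subseteq> X" using sub by (auto simp: Y_def)
  ultimately obtain A x where A: "A \<subseteq> Y" "finite A" "hit F \<Phi> A x"
    using assms unfolding unhit_def by blast
  have "\<exists>n. A \<subseteq> f n" using A(2,1)
  proof (induction A rule: finite_induct)
    case (insert a A)
    then obtain m n where "A \<subseteq> f m" "a \<in> f n" by (auto simp: Y_def)
    then have "insert a A \<subseteq> f (max m n)" using mono[of m "max m n"] mono[of n "max m n"] by auto
    then show ?case by blast
  qed simp
  then show False using hit_mono[OF A(3)] sub(3) by blast
qed

text \<open>A child adds an element above all others, so the lower bound \<open>b\<close> persists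
  down to the leaves, where the label exceeds some element.\<close>

lemma label_gt:
  assumes "label X F \<Phi> A x" "A \<noteq> {}" "\<forall>a\<in>A. b \<le> a"
  shows "b < x"
  using assms
proof (induction rule: label.induct)
  case (leaf A x)
  then show ?case unfolding hit_def by fastforce
next
  case (node S A x)
  obtain y where y: "y \<in> S" using node.hyps(1) by fastforce
  obtain a where "a \<in> A" using node.prems by blast
  then have "b \<le> y" using node.prems node.hyps(3)[OF y] by fastforce
  then show ?case using node.IH[OF y] node.prems by blast
qed

text \<open>If infinitely many children \<open>{y}\<close> of the root carried the label
  \<open>x\<close>, all these \<open>y\<close> would lie below \<open>x\<close>.\<close>

lemma not_label_empty: "\<not> label X F \<Phi> {} x"
proof
  assume "label X F \<Phi> {} x"
  then show False
  proof cases
    case leaf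
    then show ?thesis by (simp add: hit_def)
  next
    case (node S)
    have "S \<subseteq> {..<x}" using label_gt[OF node(4)] by fastforce
    then show ?thesis using node(1) finite_subset by blast
  qed
qed

text \<open>Otherwise the children labelled \<open>x\<close> would pass this label up. Hence
  \<open>child_label\<close> is finite-to-one on the labelled children of an unlabelled
  node.\<close>

lemma finite_children_if_not_label:
  assumes "\<And>x. \<not> label X F \<Phi> A x"
  shows "finite (children X F \<Phi> A {x})"
proof (rule ccontr)
  assume inf: "infinite (children X F \<Phi> A {x})"
  have "label X F \<Phi> A x"
    by (rule label.node[OF inf])
      (use assms label.leaf[of F \<Phi> A _ X] in \<open>auto simp: children_def\<close>)
  then show False using assms by blast
qed

section \<open>Reservoirs and the generic coloring\<close>

text \<open>The closure conditions are the ways in which a reservoir is shrunk later: to a tail, to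
  labelled children, to a path. Their parameters do not involve \<open>d\<close>, so
  \<open>M\<close> and \<open>c\<close> can be fixed before \<open>d\<close> is given.\<close>

definition reservoirs :: "(nat set \<Rightarrow> nat \<Rightarrow> bool) set \<Rightarrow> nat set set \<Rightarrow> bool" where
  "reservoirs P M \<longleftrightarrow> UNIV \<in> M \<and>
    (\<forall>X\<in>M. (\<forall>n. X \<inter> {n..} \<in> M) \<and>
      (\<forall>F \<Phi> A Z. finite F \<and> \<Phi> \<in> P \<and> finite A \<and> (Z = UNIV \<or> (\<exists>x. Z = {x})) \<longrightarrow>
        children X F \<Phi> A Z \<in> M) \<and>
      (\<forall>F \<Phi>. finite F \<and> \<Phi> \<in> P \<and> (\<exists>Y\<subseteq>X. infinite Y \<and> unhit F \<Phi> Y) \<longrightarrow>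
        (\<exists>Y\<in>M. Y \<subseteq> X \<and> infinite Y \<and> unhit F \<Phi> Y)))"

lemma reservoirs_UNIV: "reservoirs P M \<Longrightarrow> UNIV \<in> M"
  by (simp add: reservoirs_def)

lemma reservoirs_atLeast: "reservoirs P M \<Longrightarrow> X \<in> M \<Longrightarrow> X \<inter> {n..} \<in> M"
  by (simp add: reservoirs_def)

lemma reservoirs_children:
  "reservoirs P M \<Longrightarrow> X \<in> M \<Longrightarrow> finite F \<Longrightarrow> \<Phi> \<in> P \<Longrightarrow> finite A \<Longrightarrow>
    Z = UNIV \<or> (\<exists>x. Z = {x}) \<Longrightarrow> children X F \<Phi> A Z \<in> M"
  by (simp add: reservoirs_def)

lemma reservoirs_unhit:
  "reservoirs P M \<Longrightarrow> X \<in> M \<Longrightarrow> finite F \<Longrightarrow> \<Phi> \<in> P \<Longrightarrow>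
    \<exists>Y\<subseteq>X. infinite Y \<and> unhit F \<Phi> Y \<Longrightarrow> \<exists>Y\<in>M. Y \<subseteq> X \<and> infinite Y \<and> unhit F \<Phi> Y"
  by (simp add: reservoirs_def)

text \<open>All operations are unary, so applying the finite words over \<open>\<O>\<close> to the
  single point \<open>a\<close> yields a closed set.\<close>

lemma countable_closure:
  assumes "countable \<O>"
  shows "\<exists>M. countable M \<and> a \<in> M \<and> (\<forall>f\<in>\<O>. \<forall>x\<in>M. f x \<in> M)"
proof (intro exI conjI ballI)
  let ?M = "(\<lambda>fs. foldr (\<lambda>f. f) fs a) ` lists \<O>"
  show "countable ?M" using assms by (intro countable_image) auto
  show "a \<in> ?M" by (intro image_eqI[of _ _ "[]"]) auto
  fix f x assume "f \<in> \<O>" "x \<in> ?M"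
  then obtain fs where "fs \<in> lists \<O>" "x = foldr (\<lambda>f. f) fs a" by blast
  then show "f x \<in> ?M" using \<open>f \<in> \<O>\<close> by (intro image_eqI[of _ _ "f # fs"]) auto
qed

lemma countable_finite_nat_sets: "countable {A :: nat set. finite A}"
  using countable_Collect_finite_subset[of "UNIV :: nat set"] by simp

lemma ex_reservoirs:
  assumes "countable P"
  shows "\<exists>M. countable M \<and> reservoirs P M"
proof -
  \<comment> \<open>Where no path exists, \<open>SOME\<close> gives an arbitrary set; adding it to
    the family is harmless.\<close>
  define path where
    "path F \<Phi> X = (SOME Y. Y \<subseteq> X \<and> infinite Y \<and> unhit F \<Phi> Y)"
    for F :: "nat set" and \<Phi> :: "nat set \<Rightarrow> nat \<Rightarrow> bool" and X :: "nat set"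
  let ?fin = "{A :: nat set. finite A}"
  let ?O1 = "range (\<lambda>n X. X \<inter> {n :: nat..})"
  let ?O2 = "(\<lambda>(F, \<Phi>, A, Z) X. children X F \<Phi> A Z) `
    (?fin \<times> P \<times> ?fin \<times> insert UNIV (range (\<lambda>x. {x})))"
  let ?O3 = "(\<lambda>(F, \<Phi>). path F \<Phi>) ` (?fin \<times> P)"
  have "countable (?O1 \<union> ?O2 \<union> ?O3)"
    using assms countable_finite_nat_sets
    by (intro countable_Un countable_image countable_SIGMA countable_insert) auto
  from countable_closure[OF this, of UNIV] obtain M where M: "countable M" "UNIV \<in> M"
    "\<And>f X. f \<in> ?O1 \<union> ?O2 \<union> ?O3 \<Longrightarrow> X \<in> M \<Longrightarrow> f X \<in> M" by meson
  have "X \<inter> {n..} \<in> M" if "X \<in> M" for X n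
    using M(3)[OF UnI1[OF UnI1[OF rangeI]] that, of n] by simp
  moreover have "children X F \<Phi> A Z \<in> M"
    if "X \<in> M" "finite F" "\<Phi> \<in> P" "finite A" "Z = UNIV \<or> (\<exists>x. Z = {x})" for X F \<Phi> A Z
  proof -
    have "(\<lambda>X. children X F \<Phi> A Z) \<in> ?O2"
      using that by (intro image_eqI[of _ _ "(F, \<Phi>, A, Z)"]) auto
    from M(3)[OF UnI1[OF UnI2[OF this]] that(1)] show ?thesis .
  qed
  moreover have "\<exists>Y\<in>M. Y \<subseteq> X \<and> infinite Y \<and> unhit F \<Phi> Y"
    if "X \<in> M" "finite F" "\<Phi> \<in> P" "\<exists>Y\<subseteq>X. infinite Y \<and> unhit F \<Phi> Y" for X F \<Phi>
  proof -
    have "path F \<Phi> \<in> ?O3"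
      using that by (intro image_eqI[of _ _ "(F, \<Phi>)"]) auto
    from M(3)[OF UnI2[OF this] that(1)] have "path F \<Phi> X \<in> M" .
    moreover have "path F \<Phi> X \<subseteq> X \<and> infinite (path F \<Phi> X) \<and> unhit F \<Phi> (path F \<Phi> X)"
      unfolding path_def by (rule someI_ex[OF that(4)])
    ultimately show ?thesis by blast
  qed
  ultimately have "reservoirs P M" unfolding reservoirs_def using M(2) by simp
  then show ?thesis using M(1) by blast
qed

section \<open>Construction of the generic coloring\<close>

definition finite_to_one :: "nat set \<Rightarrow> (nat \<Rightarrow> nat) \<Rightarrow> bool" where
  "finite_to_one X g \<longleftrightarrow> (\<forall>z. finite {y \<in> X. g y = z})"

definition generic :: "nat \<Rightarrow> nat set set \<Rightarrow> (nat \<Rightarrow> nat) set \<Rightarrow> (nat \<Rightarrow> nat) \<Rightarrow> bool" where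
  "generic k M \<G> c \<longleftrightarrow> (\<forall>X G j. X \<in> M \<and> infinite X \<and> finite G \<and> G \<subseteq> \<G> \<and>
    (\<forall>g\<in>G. finite_to_one X g) \<and> j < k \<longrightarrow> (\<exists>y\<in>X. \<forall>g\<in>G. c (g y) = j))"

lemma ex_avoiding:
  assumes "infinite X" "finite G" "\<forall>g\<in>G. finite_to_one X g" "finite Z"
  shows "\<exists>y\<in>X. \<forall>g\<in>G. g y \<notin> Z"
proof (rule ccontr)
  assume "\<not> ?thesis"
  then have "X \<subseteq> (\<Union>g\<in>G. \<Union>z\<in>Z. {y \<in> X. g y = z})" by blast
  moreover have "finite (\<Union>g\<in>G. \<Union>z\<in>Z. {y \<in> X. g y = z})"
    using assms unfolding finite_to_one_def by blast
  ultimately show False using assms(1) finite_subset by blast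
qed

text \<open>The requirements \<open>(X, G, j)\<close> are countably many and are met one by one:
  each stage picks a point of \<open>X\<close> whose images under all functions in \<open>G\<close>
  are still uncolored and gives these images the color \<open>j\<close>.\<close>

lemma ex_generic:
  assumes "countable M" "countable \<G>" "0 < k"
  shows "\<exists>c. (\<forall>x. c x < k) \<and> generic k M \<G> c"
proof -
  define R where "R = {(X, G, j). X \<in> M \<and> infinite X \<and> finite G \<and> G \<subseteq> \<G> \<and>
    (\<forall>g\<in>G. finite_to_one X g) \<and> j < k}"
  have "R \<subseteq> M \<times> {G. finite G \<and> G \<subseteq> \<G>} \<times> UNIV" by (auto simp: R_def)
  moreover have "countable (M \<times> {G. finite G \<and> G \<subseteq> \<G>} \<times> (UNIV :: nat set))"
    using assms(1) countable_Collect_finite_subset[OF assms(2)] by (intro countable_SIGMA) auto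
  ultimately have cR: "countable R" using countable_subset by blast
  show ?thesis
  proof (cases "R = {}")
    case True
    have "generic k M \<G> (\<lambda>_. 0)"
      unfolding generic_def using True by (fastforce simp: R_def)
    then show ?thesis using assms(3) by (intro exI[of _ "\<lambda>_. 0"]) auto
  next
    case False
    \<comment> \<open>The enumeration may repeat a requirement; each occurrence then uses fresh
      points.\<close>
    define r where "r = from_nat_into R"
    have r: "r s \<in> R" for s using False by (simp add: r_def from_nat_into)
    let ?X = "\<lambda>s. fst (r s)" and ?G = "\<lambda>s. fst (snd (r s))" and ?j = "\<lambda>s. snd (snd (r s))"
    have rs: "infinite (?X s)" "finite (?G s)" "\<forall>g\<in>?G s. finite_to_one (?X s) g" "?j s < k" for s
      using r[of s] by (auto simp: R_def split_beta)
    \<comment> \<open>\<open>W s\<close> collects the points colored before stage \<open>s\<close>.\<close>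
    have "\<exists>W. \<forall>s. (finite (W s)) \<and>
      (\<exists>y\<in>?X s. (\<forall>g\<in>?G s. g y \<notin> W s) \<and> W (Suc s) = W s \<union> (\<lambda>g. g y) ` ?G s)"
    proof (rule dependent_nat_choice)
      show "\<exists>W :: nat set. finite W" by blast
      fix W :: "nat set" and s assume "finite W"
      then obtain y where "y \<in> ?X s" "\<forall>g\<in>?G s. g y \<notin> W" using ex_avoiding rs by meson
      then show "\<exists>W'. finite W' \<and>
          (\<exists>y\<in>?X s. (\<forall>g\<in>?G s. g y \<notin> W) \<and> W' = W \<union> (\<lambda>g. g y) ` ?G s)"
        using \<open>finite W\<close> rs(2) by (intro exI[of _ "W \<union> (\<lambda>g. g y) ` ?G s"]) auto
    qed
    then obtain W where W:
      "\<And>s. \<exists>y\<in>?X s. (\<forall>g\<in>?G s. g y \<notin> W s) \<and> W (Suc s) = W s \<union> (\<lambda>g. g y) ` ?G s" by blast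
    then obtain y where y: "\<And>s. y s \<in> ?X s" "\<And>s g. g \<in> ?G s \<Longrightarrow> g (y s) \<notin> W s"
      "\<And>s. W (Suc s) = W s \<union> (\<lambda>g. g (y s)) ` ?G s" by metis
    have mono: "W s \<subseteq> W t" if "s \<le> t" for s t
      using lift_Suc_mono_le[of W, OF _ that] y(3) by blast
    have earlier: "g (y s) \<noteq> h (y t)" if "s < t" "g \<in> ?G s" "h \<in> ?G t" for s t g h
      using mono[of "Suc s" t] y(2)[OF that(3)] y(3)[of s] that by auto
    then have uniq: "s = t" if "g \<in> ?G s" "h \<in> ?G t" "g (y s) = h (y t)" for s t g h
      using that by (metis linorder_neqE_nat)
    \<comment> \<open>By \<open>uniq\<close> at most one stage colors \<open>z\<close>. Points
      colored at no stage get the default 0, which is below \<open>k\<close>.\<close>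
    define c where "c z = (if \<exists>s. \<exists>g\<in>?G s. z = g (y s)
      then ?j (SOME s. \<exists>g\<in>?G s. z = g (y s)) else 0)" for z
    have c: "c (g (y s)) = ?j s" if "g \<in> ?G s" for g s
    proof -
      have "(SOME t. \<exists>h\<in>?G t. g (y s) = h (y t)) = s"
        using that uniq by (intro some_equality) blast+
      then show ?thesis using that by (auto simp: c_def)
    qed
    have "generic k M \<G> c"
      unfolding generic_def
    proof (intro allI impI)
      fix X G j
      assume "X \<in> M \<and> infinite X \<and> finite G \<and> G \<subseteq> \<G> \<and> (\<forall>g\<in>G. finite_to_one X g) \<and> j < k"
      then have "(X, G, j) \<in> R" by (simp add: R_def)
      then obtain s where "r s = (X, G, j)"
        unfolding r_def using cR by (metis from_nat_into_to_nat_on)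
      then show "\<exists>y\<in>X. \<forall>g\<in>G. c (g y) = j" using y(1)[of s] c[of _ s] by auto
    qed
    moreover have "c z < k" for z using rs(4) assms(3) by (auto simp: c_def)
    ultimately show ?thesis by blast
  qed
qed

section \<open>Homogeneous sets\<close>

text \<open>This is the Rasiowa-Sikorski lemma: step \<open>n\<close> enters the \<open>n\<close>-th
  set of an enumeration of \<open>\<D>\<close>.\<close>

lemma dense_sets_met:
  assumes "countable \<D>" "p0 \<in> V" "\<And>p. p \<in> V \<Longrightarrow> le p p"
    and dense: "\<And>D p. D \<in> \<D> \<Longrightarrow> p \<in> V \<Longrightarrow> \<exists>q\<in>V \<inter> D. le q p"
  shows "\<exists>p :: nat \<Rightarrow> 'a. (\<forall>n. p n \<in> V \<and> le (p (Suc n)) (p n)) \<and> (\<forall>D\<in>\<D>. \<exists>n. p n \<in> D)"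
proof (cases "\<D> = {}")
  case True
  then show ?thesis using assms(2,3) by (intro exI[of _ "\<lambda>_. p0"]) auto
next
  case False
  have "\<exists>p. \<forall>n. p n \<in> V \<and> (le (p (Suc n)) (p n) \<and> p (Suc n) \<in> from_nat_into \<D> n)"
  proof (rule dependent_nat_choice)
    fix p n assume "p \<in> V"
    then show "\<exists>q. q \<in> V \<and> le q p \<and> q \<in> from_nat_into \<D> n"
      using dense[of "from_nat_into \<D> n" p] False from_nat_into[of \<D> n] by blast
  qed (use assms(2) in blast)
  then obtain p where p: "\<And>n. p n \<in> V" "\<And>n. le (p (Suc n)) (p n)"
    "\<And>n. p (Suc n) \<in> from_nat_into \<D> n" by blast
  have "\<exists>n. p n \<in> D" if "D \<in> \<D>" for D
    using p(3)[of "to_nat_on \<D> D"] from_nat_into_to_nat_on[OF assms(1) that] by auto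
  then show ?thesis using p by blast
qed

section \<open>Limit colors and stems\<close>

definition limit_class :: "(nat list \<Rightarrow> nat) \<Rightarrow> nat \<Rightarrow> nat set" where
  "limit_class d i = {x. \<exists>s. \<forall>y\<ge>s. d [x, y] = i}"

text \<open>The common limit color \<open>i\<close> is what lets a stem be prolonged by every
  sufficiently large point of the same limit color.\<close>

definition stem :: "(nat list \<Rightarrow> nat) \<Rightarrow> nat \<Rightarrow> nat set \<Rightarrow> bool" where
  "stem d i A \<longleftrightarrow> finite A \<and> A \<subseteq> limit_class d i \<and> (\<forall>a\<in>A. \<forall>b\<in>A. a < b \<longrightarrow> d [a, b] = i)"

lemma stem_stabilises:
  assumes "stem d i A"
  shows "\<exists>s. \<forall>a\<in>A. \<forall>y\<ge>s. a < y \<and> d [a, y] = i"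
proof -
  have "\<exists>s. \<forall>y\<ge>s. a < y \<and> d [a, y] = i" if "a \<in> A" for a
  proof -
    have "a \<in> limit_class d i" using assms that by (auto simp: stem_def)
    then obtain s where "\<forall>y\<ge>s. d [a, y] = i" by (auto simp: limit_class_def)
    then show ?thesis by (intro exI[of _ "max s (Suc a)"]) auto
  qed
  then obtain f where f: "\<And>a y. a \<in> A \<Longrightarrow> f a \<le> y \<Longrightarrow> a < y \<and> d [a, y] = i" by metis
  have "finite A" using assms by (simp add: stem_def)
  then have "\<And>a y. a \<in> A \<Longrightarrow> Max (f ` A) \<le> y \<Longrightarrow> f a \<le> y"
    by (metis Max_ge finite_imageI imageI order_trans)
  then show ?thesis using f by blast
qed

lemma stem_insert:
  assumes "stem d i A" "y \<in> limit_class d i" "\<forall>a\<in>A. a < y \<and> d [a, y] = i"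
  shows "stem d i (insert y A)"
  using assms unfolding stem_def by fastforce

lemma ex_stem_insert:
  assumes "stem d i A" "infinite (S \<inter> limit_class d i)"
  shows "\<exists>y\<in>S. n \<le> y \<and> (\<forall>a\<in>A. a < y) \<and> stem d i (insert y A)"
proof -
  obtain s where s: "\<forall>a\<in>A. \<forall>y\<ge>s. a < y \<and> d [a, y] = i" using stem_stabilises[OF assms(1)] by blast
  obtain y where "y \<in> S \<inter> limit_class d i" "max s n \<le> y"
    using assms(2) infinite_nat_iff_unbounded_le by blast
  then show ?thesis using s stem_insert[OF assms(1)] by (intro bexI[of _ y]) auto
qed

section \<open>Descent in the trees along one limit color\<close>

definition splits :: "(nat list \<Rightarrow> nat) \<Rightarrow> nat set set \<Rightarrow> nat \<Rightarrow> nat set \<Rightarrow> bool" where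
  "splits d M i X \<longleftrightarrow> (\<forall>Y\<in>M. Y \<subseteq> X \<and> infinite Y \<longrightarrow> infinite (Y \<inter> limit_class d i))"

lemma splits_subset: "splits d M i X \<Longrightarrow> Y \<subseteq> X \<Longrightarrow> splits d M i Y"
  unfolding splits_def by blast

text \<open>At an unhit node labelled \<open>x\<close>, the children labelled \<open>x\<close> form
  an infinite reservoir, so by \<open>splits\<close> one of them extends the stem. By
  well-foundedness this descent stops, and it can stop only at a node hitting
  \<open>x\<close>.\<close>

lemma hit_if_label:
  assumes "reservoirs P M" "X \<in> M" "splits d M i X" "finite F" "\<Phi> \<in> P"
    and "wf (unhit_tree X F \<Phi>)"
    and "label X F \<Phi> A x" "stem d i A" "A \<subseteq> X"
  shows "\<exists>A'\<subseteq>X. stem d i A' \<and> hit F \<Phi> A' x"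
  using assms(6-)
proof (induction A rule: wf_induct_rule)
  case (less A)
  show ?case
  proof (cases "hit F \<Phi> A x")
    case True
    then show ?thesis using less.prems by blast
  next
    case False
    have finA: "finite A" using less.prems by (simp add: stem_def)
    from less.prems(1) obtain S where S: "infinite S" "S \<subseteq> X" "\<And>y. y \<in> S \<Longrightarrow> \<forall>a\<in>A. a < y"
      "\<And>y. y \<in> S \<Longrightarrow> label X F \<Phi> (insert y A) x" and unhit: "\<And>z. \<not> hit F \<Phi> A z"
      using False by (cases rule: label.cases) auto
    \<comment> \<open>The witness \<open>S\<close> of the label need not be a reservoir, but the set
      of all children labelled \<open>x\<close> is one.\<close>
    let ?C = "children X F \<Phi> A {x}"
    have "S \<subseteq> ?C" using S by (auto simp: children_def)
    then have "infinite ?C" using S(1) finite_subset by blast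
    moreover have "?C \<in> M" by (rule reservoirs_children[OF assms(1,2,4,5) finA]) blast
    moreover have "?C \<subseteq> X" by (auto simp: children_def)
    ultimately have "infinite (?C \<inter> limit_class d i)" using assms(3) unfolding splits_def by blast
    from ex_stem_insert[OF less.prems(2) this] obtain y where
      y: "y \<in> ?C" "\<forall>a\<in>A. a < y" "stem d i (insert y A)" by blast
    then have "(insert y A, A) \<in> unhit_tree X F \<Phi>"
      using finA less.prems(3) unhit by (auto simp: unhit_tree_def children_def)
    then show ?thesis
      using less.IH[of "insert y A"] y less.prems(3) by (auto simp: children_def)
  qed
qed

text \<open>While only finitely many children are labelled, some unlabelled child extends the stem;
  well-foundedness ends this descent.\<close>

lemma ex_unlabelled_with_labelled_children:
  assumes "X \<in> M" "infinite X" "splits d M i X"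
    and "wf (unhit_tree X F \<Phi>)"
    and "\<And>x. \<not> label X F \<Phi> A x" "stem d i A" "A \<subseteq> X"
  shows "\<exists>A'\<subseteq>X. stem d i A' \<and> (\<forall>x. \<not> label X F \<Phi> A' x) \<and> infinite (children X F \<Phi> A' UNIV)"
  using assms(4-)
proof (induction A rule: wf_induct_rule)
  case (less A)
  show ?case
  proof (cases "infinite (children X F \<Phi> A UNIV)")
    case True
    then show ?thesis using less.prems by blast
  next
    case False
    have "infinite (X \<inter> limit_class d i)" using assms unfolding splits_def by blast
    moreover have "(X - children X F \<Phi> A UNIV) \<inter> limit_class d i =
      (X \<inter> limit_class d i) - children X F \<Phi> A UNIV" by blast
    ultimately have "infinite ((X - children X F \<Phi> A UNIV) \<inter> limit_class d i)"
      using False Diff_infinite_finite by auto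
    from ex_stem_insert[OF less.prems(2) this] obtain y where
      y: "y \<in> X - children X F \<Phi> A UNIV" "\<forall>a\<in>A. a < y" "stem d i (insert y A)" by blast
    have "finite A" using less.prems by (simp add: stem_def)
    moreover have "\<not> hit F \<Phi> A z" for z using less.prems(1) label.leaf by blast
    ultimately have "(insert y A, A) \<in> unhit_tree X F \<Phi>"
      using y less.prems(3) by (auto simp: unhit_tree_def)
    moreover have "\<not> label X F \<Phi> (insert y A) x" for x using y by (auto simp: children_def)
    ultimately show ?thesis using less.IH[of "insert y A"] y less.prems(3) by auto
  qed
qed

text \<open>These are the functions against which \<open>c\<close> must be generic. They are
  countably many and the same for all \<open>d\<close>.\<close>

definition labellings :: "(nat set \<Rightarrow> nat \<Rightarrow> bool) set \<Rightarrow> nat set set \<Rightarrow> (nat \<Rightarrow> nat) set" where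
  "labellings P M = {child_label X F \<Phi> A | X F \<Phi> A. X \<in> M \<and> finite F \<and> \<Phi> \<in> P \<and> finite A}"

lemma countable_labellings:
  assumes "countable P" "countable M"
  shows "countable (labellings P M)"
proof -
  let ?fin = "{A :: nat set. finite A}"
  have "labellings P M = (\<lambda>(X, F, \<Phi>, A). child_label X F \<Phi> A) ` (M \<times> ?fin \<times> P \<times> ?fin)"
    by (auto simp: labellings_def image_def)
  then show ?thesis using assms countable_finite_nat_sets by auto
qed

text \<open>The stems come from \<open>X\<close>, the arguments of \<open>g\<close> from a smaller
  reservoir \<open>X'\<close>. Keeping the two apart allows \<open>X'\<close> to shrink further
  while the remaining colors are treated.\<close>

definition hitting :: "(nat list \<Rightarrow> nat) \<Rightarrow> nat \<Rightarrow> nat set \<Rightarrow> nat set \<Rightarrow> (nat set \<Rightarrow> nat \<Rightarrow> bool) \<Rightarrow>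
    nat set \<Rightarrow> (nat \<Rightarrow> nat) \<Rightarrow> bool" where
  "hitting d i X F \<Phi> X' g \<longleftrightarrow> finite_to_one X' g \<and>
    (\<forall>y\<in>X' \<inter> limit_class d i. \<exists>A\<subseteq>X. stem d i A \<and> hit F \<Phi> A (g y))"

lemma hitting_mono:
  assumes "hitting d i X F \<Phi> X' g" "Y \<subseteq> X'" "X \<subseteq> Z"
  shows "hitting d i Z F \<Phi> Y g"
proof -
  have "finite {y \<in> Y. g y = z}" for z
    by (rule finite_subset[of _ "{y \<in> X'. g y = z}"])
      (use assms in \<open>auto simp: hitting_def finite_to_one_def\<close>)
  moreover have "\<exists>A\<subseteq>Z. stem d i A \<and> hit F \<Phi> A (g y)" if "y \<in> Y \<inter> limit_class d i" for y
  proof -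
    have "\<exists>A\<subseteq>X. stem d i A \<and> hit F \<Phi> A (g y)"
      using assms(1,2) that unfolding hitting_def by blast
    then show ?thesis using assms(3) by (meson order_trans)
  qed
  ultimately show ?thesis unfolding hitting_def finite_to_one_def by simp
qed

text \<open>Either the tree has an infinite path, which can then be taken in \<open>M\<close>, or it
  is well-founded. In the second case \<open>g\<close> labels the children of an unlabelled node
  having infinitely many labelled children.\<close>

lemma unhit_or_hitting:
  assumes "reservoirs P M" "X \<in> M" "infinite X" "splits d M i X" "finite F" "\<Phi> \<in> P"
  shows "(\<exists>Y\<in>M. Y \<subseteq> X \<and> infinite Y \<and> unhit F \<Phi> Y) \<or>
    (\<exists>X'\<in>M. X' \<subseteq> X \<and> infinite X' \<and> (\<exists>g\<in>labellings P M. hitting d i X F \<Phi> X' g))"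
proof (cases "\<exists>Y\<subseteq>X. infinite Y \<and> unhit F \<Phi> Y")
  case True
  then show ?thesis by (intro disjI1 reservoirs_unhit[OF assms(1,2,5,6)])
next
  case False
  then have wf: "wf (unhit_tree X F \<Phi>)" by (intro wf_unhit_tree) blast
  have "stem d i {}" by (simp add: stem_def)
  with ex_unlabelled_with_labelled_children[OF assms(2-4) wf not_label_empty]
  obtain A where A: "A \<subseteq> X" "stem d i A" "\<And>x. \<not> label X F \<Phi> A x"
    "infinite (children X F \<Phi> A UNIV)" by blast
  obtain s where s: "\<forall>a\<in>A. \<forall>y\<ge>s. a < y \<and> d [a, y] = i" using stem_stabilises[OF A(2)] by blast
  \<comment> \<open>Beyond \<open>s\<close>, every point of limit color \<open>i\<close> extends the
    stem \<open>A\<close>.\<close>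
  let ?X' = "children X F \<Phi> A UNIV \<inter> {s..}" and ?g = "child_label X F \<Phi> A"
  have finA: "finite A" using A(2) by (simp add: stem_def)
  have g: "label X F \<Phi> (insert y A) (?g y)" if "y \<in> children X F \<Phi> A UNIV" for y
    using that unfolding children_def child_label_def by (auto intro: someI)
  have "?X' \<in> M"
    by (rule reservoirs_atLeast[OF assms(1) reservoirs_children[OF assms(1,2,5,6) finA]]) simp
  moreover have "?X' \<subseteq> X" by (auto simp: children_def)
  moreover have "infinite ?X'"
  proof -
    have "children X F \<Phi> A UNIV \<inter> {s..} = children X F \<Phi> A UNIV - {..<s}" by auto
    then show ?thesis using A(4) by (simp add: Diff_infinite_finite)
  qed
  moreover have "?g \<in> labellings P M" using assms(2,5,6) finA unfolding labellings_def by blast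
  moreover have "hitting d i X F \<Phi> ?X' ?g"
    unfolding hitting_def
  proof (intro conjI ballI)
    show "finite_to_one ?X' ?g"
      unfolding finite_to_one_def
    proof
      fix z
      have "{y \<in> ?X'. ?g y = z} \<subseteq> children X F \<Phi> A {z}" using g by (auto simp: children_def)
      then show "finite {y \<in> ?X'. ?g y = z}"
        using finite_children_if_not_label[OF A(3)] finite_subset by blast
    qed
    fix y assume y: "y \<in> ?X' \<inter> limit_class d i"
    then have "stem d i (insert y A)" using s by (intro stem_insert[OF A(2)]) auto
    moreover have "insert y A \<subseteq> X" using y A(1) by (auto simp: children_def)
    ultimately show "\<exists>A\<subseteq>X. stem d i A \<and> hit F \<Phi> A (?g y)"
      using hit_if_label[OF assms(1,2,4-6) wf g] y by blast
  qed
  ultimately show ?thesis by blast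
qed

text \<open>The colors are treated in turn, each inside the reservoir left by the previous ones;
  \<open>hitting_mono\<close> preserves what was achieved before.\<close>

lemma unhit_or_all_hitting:
  assumes "reservoirs P M" "X \<in> M" "infinite X"
    and "finite J" "\<forall>i\<in>J. splits d M i X \<and> finite (F i) \<and> \<Phi> i \<in> P"
  shows "(\<exists>i\<in>J. \<exists>Y\<in>M. Y \<subseteq> X \<and> infinite Y \<and> unhit (F i) (\<Phi> i) Y) \<or>
    (\<exists>X'\<in>M. X' \<subseteq> X \<and> infinite X' \<and>
      (\<exists>g. \<forall>i\<in>J. g i \<in> labellings P M \<and> hitting d i X (F i) (\<Phi> i) X' (g i)))"
  using assms(4,5)
proof (induction J rule: finite_induct)
  case empty
  then show ?case using assms by blast
next
  case (insert i J)
  show ?case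
  proof (cases "\<exists>i\<in>J. \<exists>Y\<in>M. Y \<subseteq> X \<and> infinite Y \<and> unhit (F i) (\<Phi> i) Y")
    case False
    then obtain X' g where X': "X' \<in> M" "X' \<subseteq> X" "infinite X'"
      and g: "\<And>i. i \<in> J \<Longrightarrow> g i \<in> labellings P M \<and> hitting d i X (F i) (\<Phi> i) X' (g i)"
      using insert by blast
    have i: "splits d M i X'" "finite (F i)" "\<Phi> i \<in> P"
      using insert.prems X'(2) splits_subset by blast+
    consider (unhit) Y where "Y \<in> M" "Y \<subseteq> X'" "infinite Y" "unhit (F i) (\<Phi> i) Y"
      | (hitting) X'' h where "X'' \<in> M" "X'' \<subseteq> X'" "infinite X''" "h \<in> labellings P M"
          "hitting d i X' (F i) (\<Phi> i) X'' h"
      using unhit_or_hitting[OF assms(1) X'(1,3) i] by blast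
    then show ?thesis
    proof cases
      case unhit
      then show ?thesis using X'(2) by blast
    next
      case hitting
      have "hitting d i X (F i) (\<Phi> i) X'' h"
        using hitting(5) X'(2) hitting_mono by blast
      moreover have "hitting d j X (F j) (\<Phi> j) X'' (g j)" if "j \<in> J" for j
        using g[OF that] hitting(2) hitting_mono by blast
      ultimately have "\<forall>j\<in>insert i J. (g(i := h)) j \<in> labellings P M \<and>
          hitting d j X (F j) (\<Phi> j) X'' ((g(i := h)) j)"
        using g hitting(4) by simp
      moreover have "X'' \<subseteq> X" using hitting(2) X'(2) by blast
      ultimately show ?thesis using hitting(1,3) by blast
    qed
  qed blast
qed

section \<open>Mathias conditions and density\<close>

text \<open>A Mathias condition consists of one stem for each color in \<open>I\<close> and a common reservoir.\<close>

definition condition :: "(nat list \<Rightarrow> nat) \<Rightarrow> nat set set \<Rightarrow> nat set \<Rightarrow> nat set \<Rightarrow>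
    (nat \<Rightarrow> nat set) \<times> nat set \<Rightarrow> bool" where
  "condition d M I X0 = (\<lambda>(F, X). X \<in> M \<and> infinite X \<and> X \<subseteq> X0 \<and>
    (\<forall>i\<in>I. stem d i (F i) \<and> (\<forall>a\<in>F i. \<forall>y\<in>X. a < y \<and> d [a, y] = i)))"

definition extends :: "nat set \<Rightarrow> (nat \<Rightarrow> nat set) \<times> nat set \<Rightarrow> (nat \<Rightarrow> nat set) \<times> nat set \<Rightarrow> bool" where
  "extends I = (\<lambda>(F', X') (F, X). X' \<subseteq> X \<and> (\<forall>i\<in>I. F i \<subseteq> F' i \<and> F' i \<subseteq> F i \<union> X))"

text \<open>\<open>t i\<close> guesses that its functional enumerates an infinite set from the set
  built for \<open>i\<close>, and that \<open>c\<close> has the constant value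
  \<open>snd (t i)\<close> there. Refuting this for all \<open>H\<close> compatible with the
  condition covers the set built in the end.\<close>

definition defeats :: "(nat \<Rightarrow> nat) \<Rightarrow> nat set \<Rightarrow> (nat \<Rightarrow> (nat set \<Rightarrow> nat \<Rightarrow> bool) \<times> nat) \<Rightarrow>
    (nat \<Rightarrow> nat set) \<times> nat set \<Rightarrow> bool" where
  "defeats c I t = (\<lambda>(F, X). \<exists>i\<in>I. \<forall>H. F i \<subseteq> H \<and> H \<subseteq> F i \<union> X \<longrightarrow>
    finite {x. fst (t i) H x} \<or> (\<exists>x. fst (t i) H x \<and> c x \<noteq> snd (t i)))"

lemma condition_extend_stem:
  assumes "reservoirs P M" "condition d M I X0 (F, X)" "i \<in> I"
    and "stem d i A" "A \<subseteq> X" "E \<subseteq> A"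
  shows "\<exists>n. (\<forall>a\<in>A. a < n) \<and> condition d M I X0 (F(i := F i \<union> E), X \<inter> {n..}) \<and>
    extends I (F(i := F i \<union> E), X \<inter> {n..}) (F, X)"
proof -
  have cond: "X \<in> M" "infinite X" "X \<subseteq> X0"
    "\<And>i. i \<in> I \<Longrightarrow> stem d i (F i)" "\<And>i a y. i \<in> I \<Longrightarrow> a \<in> F i \<Longrightarrow> y \<in> X \<Longrightarrow> a < y \<and> d [a, y] = i"
    using assms(2) by (auto simp: condition_def)
  \<comment> \<open>The reservoir is cut beyond all of \<open>A\<close>, not only \<open>E\<close>,
    because \<open>hit\<close> asks later elements to lie above the whole node.\<close>
  obtain n where n: "\<forall>a\<in>A. \<forall>y\<ge>n. a < y \<and> d [a, y] = i" using stem_stabilises[OF assms(4)] by blast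
  have "stem d i (F i \<union> E)"
    unfolding stem_def
  proof (intro conjI ballI impI)
    show "finite (F i \<union> E)" "F i \<union> E \<subseteq> limit_class d i"
      using cond(4)[OF assms(3)] assms(4,6) finite_subset unfolding stem_def by blast+
    fix a b assume ab: "a \<in> F i \<union> E" "b \<in> F i \<union> E" "a < b"
    \<comment> \<open>Elements of \<open>E\<close> come from the reservoir and so lie above the old
      stem.\<close>
    have "\<not> (a \<in> E \<and> b \<in> F i)"
      using cond(5)[OF assms(3), of b a] ab(3) assms(5,6) by auto
    then show "d [a, b] = i"
      using ab cond(4)[OF assms(3)] cond(5)[OF assms(3), of a b] assms(4-6)
      unfolding stem_def by blast
  qed
  moreover have "infinite (X \<inter> {n..})"
  proof -
    have "X \<inter> {n..} = X - {..<n}" by auto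
    then show ?thesis using cond(2) by (simp add: Diff_infinite_finite)
  qed
  moreover have "X \<inter> {n..} \<in> M" by (rule reservoirs_atLeast[OF assms(1) cond(1)])
  ultimately have "condition d M I X0 (F(i := F i \<union> E), X \<inter> {n..})"
    using cond n assms(6) unfolding condition_def by auto
  moreover have "extends I (F(i := F i \<union> E), X \<inter> {n..}) (F, X)"
    using assms(5,6) unfolding extends_def by auto
  ultimately show ?thesis using n by blast
qed

lemma dense_unbounded:
  assumes "reservoirs P M" "condition d M I X0 (F, X)" "i \<in> I" "splits d M i X0"
  shows "\<exists>q. condition d M I X0 q \<and> extends I q (F, X) \<and> (\<exists>a\<in>fst q i. n \<le> a)"
proof -
  have "infinite (X \<inter> limit_class d i)"
    using assms(2,4) unfolding condition_def splits_def by auto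
  moreover have "stem d i {}" by (simp add: stem_def)
  ultimately obtain y where y: "y \<in> X" "n \<le> y" "stem d i {y}" using ex_stem_insert by blast
  from condition_extend_stem[OF assms(1-3) y(3), of "{y}"] y obtain m where
    "condition d M I X0 (F(i := F i \<union> {y}), X \<inter> {m..})"
    "extends I (F(i := F i \<union> {y}), X \<inter> {m..}) (F, X)" by auto
  then show ?thesis using y(2) by (intro exI[of _ "(F(i := F i \<union> {y}), X \<inter> {m..})"]) simp
qed

text \<open>If some reservoir inside \<open>X\<close> is a path for some \<open>i\<close>, passing
  to it leaves that functional only finitely many numbers. Otherwise a missed color \<open>j\<close>
  and genericity give a point \<open>y\<close>, and the functional for the limit color of
  \<open>y\<close> is made to enumerate a number of color \<open>j\<close>.\<close>

lemma dense_defeats: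
  assumes "reservoirs P M" "generic k M (labellings P M) c" "\<forall>\<Phi>\<in>P. finite_use \<Phi>"
    and "finite I" "card I < k" "\<forall>i\<in>I. splits d M i X0" "X0 \<subseteq> (\<Union>i\<in>I. limit_class d i)"
    and "\<forall>i\<in>I. fst (t i) \<in> P" "condition d M I X0 (F, X)"
  shows "\<exists>q. condition d M I X0 q \<and> extends I q (F, X) \<and> defeats c I t q"
proof -
  have cond: "X \<in> M" "infinite X" "X \<subseteq> X0"
    "\<And>i. i \<in> I \<Longrightarrow> stem d i (F i)" "\<And>i a y. i \<in> I \<Longrightarrow> a \<in> F i \<Longrightarrow> y \<in> X \<Longrightarrow> a < y \<and> d [a, y] = i"
    using assms(9) by (auto simp: condition_def)
  have "\<forall>i\<in>I. splits d M i X \<and> finite (F i) \<and> fst (t i) \<in> P"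
    using assms(6,8) cond(3,4) splits_subset unfolding stem_def by blast
  from unhit_or_all_hitting[OF assms(1) cond(1,2) assms(4) this]
  consider (unhit) i Y where "i \<in> I" "Y \<in> M" "Y \<subseteq> X" "infinite Y" "unhit (F i) (fst (t i)) Y"
    | (hitting) X' g where "X' \<in> M" "X' \<subseteq> X" "infinite X'" "\<And>i. i \<in> I \<Longrightarrow>
        g i \<in> labellings P M \<and> hitting d i X (F i) (fst (t i)) X' (g i)"
    by blast
  then show ?thesis
  proof cases
    case unhit
    have "condition d M I X0 (F, Y)" using cond unhit(2-4) unfolding condition_def by blast
    moreover have "extends I (F, Y) (F, X)" using unhit(3) unfolding extends_def by auto
    moreover have "defeats c I t (F, Y)"
      using unhit finite_if_unhit[OF _ unhit(4,5)] assms(3,8) unfolding defeats_def by blast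
    ultimately show ?thesis by blast
  next
    case hitting
    \<comment> \<open>Pigeonhole: fewer than \<open>k\<close> colors are guessed, so some
      \<open>j\<close> differs from all of them.\<close>
    have "card ((snd \<circ> t) ` I) < card {..<k}"
      using card_image_le[OF assms(4), of "snd \<circ> t"] assms(5) by simp
    then have "\<not> {..<k} \<subseteq> (snd \<circ> t) ` I" using card_mono assms(4) by (metis finite_imageI not_le)
    then obtain j where j: "j < k" "\<And>i. i \<in> I \<Longrightarrow> j \<noteq> snd (t i)" by auto
    have "finite (g ` I)" "g ` I \<subseteq> labellings P M" "\<forall>h\<in>g ` I. finite_to_one X' h"
      using assms(4) hitting(4) unfolding hitting_def by auto
    then obtain y where y: "y \<in> X'" "\<And>i. i \<in> I \<Longrightarrow> c (g i y) = j"
      using assms(2) hitting(1,3) j(1) unfolding generic_def by (metis imageI)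
    \<comment> \<open>Only here is it settled which guess fails: the limit color of \<open>y\<close>
      lies in \<open>I\<close> because the classes cover \<open>X0\<close>.\<close>
    obtain i where i: "i \<in> I" "y \<in> limit_class d i"
      using y(1) hitting(2) cond(3) assms(7) by blast
    then obtain A where A: "A \<subseteq> X" "stem d i A" "hit (F i) (fst (t i)) A (g i y)"
      using hitting(4) y(1) unfolding hitting_def by blast
    then obtain E where E: "E \<subseteq> A" "\<And>H. F i \<union> E \<subseteq> H \<Longrightarrow>
        (\<forall>h\<in>H - (F i \<union> E). \<forall>a\<in>A. a < h) \<Longrightarrow> fst (t i) H (g i y)"
      unfolding hit_def by meson
    obtain n where n: "\<forall>a\<in>A. a < n" "condition d M I X0 (F(i := F i \<union> E), X \<inter> {n..})"
      "extends I (F(i := F i \<union> E), X \<inter> {n..}) (F, X)"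
      using condition_extend_stem[OF assms(1,9) i(1) A(2,1) E(1)] by blast
    have "fst (t i) H (g i y)" if H: "F i \<union> E \<subseteq> H" "H \<subseteq> F i \<union> E \<union> X \<inter> {n..}" for H
    proof (rule E(2)[OF H(1)], intro ballI)
      fix h a assume "h \<in> H - (F i \<union> E)" "a \<in> A"
      then have "n \<le> h" "a < n" using H(2) n(1) by auto
      then show "a < h" by simp
    qed
    moreover have "c (g i y) \<noteq> snd (t i)" using y(2) j(2) i(1) by simp
    ultimately have "\<forall>H. (F(i := F i \<union> E)) i \<subseteq> H \<and> H \<subseteq> (F(i := F i \<union> E)) i \<union> X \<inter> {n..} \<longrightarrow>
        finite {x. fst (t i) H x} \<or> (\<exists>x. fst (t i) H x \<and> c x \<noteq> snd (t i))"
      unfolding fun_upd_same by meson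
    then have "defeats c I t (F(i := F i \<union> E), X \<inter> {n..})"
      unfolding defeats_def prod.case using i(1) by (rule bexI)
    then show ?thesis using n by blast
  qed
qed

text \<open>\<open>I\<close> has least cardinality among the sets of colors whose classes cover an
  infinite reservoir. If a reservoir inside \<open>X\<close> met class \<open>i\<close> only
  finitely often, a tail of it would be covered without \<open>i\<close>.\<close>

lemma ex_minimal_colors:
  assumes "reservoirs P M" "stable_coloring l d"
  shows "\<exists>I X. I \<subseteq> {..<l} \<and> X \<in> M \<and> infinite X \<and> X \<subseteq> (\<Union>i\<in>I. limit_class d i) \<and>
    (\<forall>i\<in>I. splits d M i X)"
proof -
  define Q where "Q I \<longleftrightarrow> I \<subseteq> {..<l} \<and> (\<exists>X\<in>M. infinite X \<and> X \<subseteq> (\<Union>i\<in>I. limit_class d i))" for I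
  have "UNIV \<subseteq> (\<Union>i\<in>{..<l}. limit_class d i)"
    using assms(2) unfolding stable_coloring_def limit_class_def by blast
  then have "Q {..<l}" unfolding Q_def using reservoirs_UNIV[OF assms(1)] by blast
  then obtain I where I: "Q I" "\<And>J. Q J \<Longrightarrow> card I \<le> card J"
    using exists_least_iff[of "\<lambda>n. \<exists>I. Q I \<and> card I = n"] by (metis not_le)
  then obtain X where X: "I \<subseteq> {..<l}" "X \<in> M" "infinite X" "X \<subseteq> (\<Union>i\<in>I. limit_class d i)"
    unfolding Q_def by blast
  have "infinite (Y \<inter> limit_class d i)" if iY: "i \<in> I" "Y \<in> M" "Y \<subseteq> X" "infinite Y" for i Y
  proof
    assume "finite (Y \<inter> limit_class d i)"
    then obtain n where n: "\<forall>y\<in>Y \<inter> limit_class d i. y < n" using finite_nat_set_iff_bounded by blast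
    have "Y \<inter> {n..} \<subseteq> (\<Union>i\<in>I - {i}. limit_class d i)"
    proof
      fix y assume y: "y \<in> Y \<inter> {n..}"
      then obtain i' where "i' \<in> I" "y \<in> limit_class d i'" using X(4) iY(3) by blast
      moreover have "y \<notin> limit_class d i" using n[rule_format, of y] y by auto
      ultimately show "y \<in> (\<Union>i\<in>I - {i}. limit_class d i)" by blast
    qed
    moreover have "infinite (Y \<inter> {n..})"
    proof -
      have "Y \<inter> {n..} = Y - {..<n}" by auto
      then show ?thesis using iY(4) by (simp add: Diff_infinite_finite)
    qed
    moreover have "Y \<inter> {n..} \<in> M" by (rule reservoirs_atLeast[OF assms(1) iY(2)])
    ultimately have "Q (I - {i})" unfolding Q_def using X(1) by blast
    moreover have "card (I - {i}) < card I"
      using iY(1) X(1) finite_subset by (intro psubset_card_mono) auto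
    ultimately show False using I(2) by (metis not_le)
  qed
  then show ?thesis using X unfolding splits_def by blast
qed

section \<open>The homogeneous sets\<close>

lemma homogeneous_pairsI:
  assumes "\<And>a b. a \<in> H \<Longrightarrow> b \<in> H \<Longrightarrow> a < b \<Longrightarrow> d [a, b] = i"
  shows "homogeneous 2 d H"
  unfolding homogeneous_def
proof (intro exI ballI)
  fix xs assume "xs \<in> tuples H 2"
  then obtain a b where "xs = [a, b]" "a < b" "a \<in> H" "b \<in> H"
    by (auto simp: tuples_def numeral_2_eq_2 length_Suc_conv)
  then show "d xs = i" using assms by simp
qed

text \<open>A sequence of conditions meets the dense sets for unboundedness and for all families of
  guesses; \<open>H i\<close> is the union of its stems of color \<open>i\<close>. Which of the
  \<open>H i\<close> works is not determined explicitly.\<close>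

lemma ex_homogeneous_not_enumerating:
  assumes "countable P" "\<forall>\<Phi>\<in>P. finite_use \<Phi>" "reservoirs P M" "generic k M (labellings P M) c"
    and "l < k" "stable_coloring l d"
  shows "\<exists>H. infinite H \<and> homogeneous 2 d H \<and>
    (\<forall>\<Phi>\<in>P. \<forall>j. finite {x. \<Phi> H x} \<or> (\<exists>x. \<Phi> H x \<and> c x \<noteq> j))"
proof -
  obtain I X0 where I: "I \<subseteq> {..<l}" "X0 \<in> M" "infinite X0" "X0 \<subseteq> (\<Union>i\<in>I. limit_class d i)"
    "\<forall>i\<in>I. splits d M i X0" using ex_minimal_colors[OF assms(3,6)] by blast
  have finI: "finite I" using I(1) finite_subset by blast
  have cardI: "card I < k" using card_mono[OF _ I(1)] assms(5) by simp
  define V where "V = Collect (condition d M I X0)"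
  define U where "U i n = {q :: (nat \<Rightarrow> nat set) \<times> nat set. \<exists>a\<in>fst q i. n \<le> a}" for i n :: nat
  let ?T = "I \<rightarrow>\<^sub>E P \<times> (UNIV :: nat set)"
  define \<D> where
    "\<D> = (\<lambda>(i, n). U i n) ` (I \<times> UNIV) \<union> (\<lambda>t. Collect (defeats c I t)) ` ?T"
  have unbounded_mem: "U i n \<in> \<D>" if "i \<in> I" for i n
    unfolding \<D>_def using that by (intro UnI1 image_eqI[of _ _ "(i, n)"]) auto
  have defeats_mem: "Collect (defeats c I t) \<in> \<D>" if "t \<in> ?T" for t
    unfolding \<D>_def by (rule UnI2[OF imageI[OF that]])
  have "countable \<D>"
    unfolding \<D>_def using assms(1) finI by (intro countable_Un countable_image countable_SIGMA countable_PiE) auto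
  moreover have "((\<lambda>_. {}), X0) \<in> V" using I by (auto simp: V_def condition_def stem_def)
  moreover have "extends I p p" for p by (auto simp: extends_def)
  moreover have "\<exists>q\<in>V \<inter> D. extends I q p" if D: "D \<in> \<D>" and p: "p \<in> V" for D p
  proof -
    obtain F X where FX: "p = (F, X)" "condition d M I X0 (F, X)"
      using p by (cases p) (auto simp: V_def)
    consider i n where "i \<in> I" "D = U i n" | t where "t \<in> ?T" "D = Collect (defeats c I t)"
      using D unfolding \<D>_def by (elim UnE imageE SigmaE) auto
    then show ?thesis
    proof cases
      case 1
      then obtain q where "condition d M I X0 q" "extends I q (F, X)" "\<exists>a\<in>fst q i. n \<le> a"
        using dense_unbounded[OF assms(3) FX(2), of i n] I(5) by blast
      then show ?thesis unfolding V_def U_def 1(2) FX(1) by blast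
    next
      case 2
      then have "\<forall>i\<in>I. fst (t i) \<in> P" by (metis PiE_mem mem_Times_iff)
      from dense_defeats[OF assms(3,4,2) finI cardI I(5,4) this FX(2)] show ?thesis
        unfolding V_def 2(2) FX(1) by blast
    qed
  qed
  ultimately obtain p where p: "\<And>n. p n \<in> V" "\<And>n. extends I (p (Suc n)) (p n)"
    "\<And>D. D \<in> \<D> \<Longrightarrow> \<exists>n. p n \<in> D"
    using dense_sets_met[of \<D> "((\<lambda>_. {}), X0)" V "extends I"] by metis
  let ?F = "\<lambda>n. fst (p n)" and ?X = "\<lambda>n. snd (p n)"
  have shrink: "?X (Suc n) \<subseteq> ?X n" "\<And>i. i \<in> I \<Longrightarrow> ?F n i \<subseteq> ?F (Suc n) i"
    "\<And>i. i \<in> I \<Longrightarrow> ?F (Suc n) i \<subseteq> ?F n i \<union> ?X n" for n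
    using p(2)[of n] by (auto simp: extends_def split_beta)
  have Xmono: "?X n \<subseteq> ?X m" if "m \<le> n" for m n
    using lift_Suc_antimono_le[of ?X, OF shrink(1) that] .
  have Fmono: "?F m i \<subseteq> ?F n i" if "m \<le> n" "i \<in> I" for m n i
    using lift_Suc_mono_le[of "\<lambda>n. ?F n i", OF shrink(2)[OF that(2)] that(1)] .
  have Fsub: "?F n i \<subseteq> ?F m i \<union> ?X m" if i: "i \<in> I" for m n i
  proof (cases "m \<le> n")
    case True
    then show ?thesis
    proof (induction n rule: dec_induct)
      case (step n)
      then show ?case using shrink(3)[OF i, of n] Xmono[of m n] by blast
    qed simp
  next
    case False
    then show ?thesis using Fmono[OF _ i, of n m] by auto
  qed
  define H where "H i = (\<Union>n. ?F n i)" for i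
  have H_between: "?F n i \<subseteq> H i \<and> H i \<subseteq> ?F n i \<union> ?X n" if "i \<in> I" for n i
    using Fsub[OF that] by (auto simp: H_def)
  have H_infinite: "infinite (H i)" if "i \<in> I" for i
    unfolding infinite_nat_iff_unbounded_le
  proof
    fix n
    from p(3)[OF unbounded_mem[OF that]] obtain m where "p m \<in> U i n" by blast
    then show "\<exists>a\<ge>n. a \<in> H i" by (auto simp: U_def H_def)
  qed
  have H_homogeneous: "homogeneous 2 d (H i)" if "i \<in> I" for i
  proof (rule homogeneous_pairsI)
    fix a b assume ab: "a \<in> H i" "b \<in> H i" "a < b"
    then obtain m n where "a \<in> ?F m i" "b \<in> ?F n i" by (auto simp: H_def)
    then have "a \<in> ?F (max m n) i" "b \<in> ?F (max m n) i"
      using Fmono[OF _ that, of m "max m n"] Fmono[OF _ that, of n "max m n"] by auto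
    moreover have "stem d i (?F (max m n) i)"
      using p(1)[of "max m n"] that unfolding V_def condition_def split_beta by blast
    ultimately show "d [a, b] = i" using ab(3) by (simp add: stem_def)
  qed
  have "\<exists>i\<in>I. \<forall>\<Phi>\<in>P. \<forall>j. finite {x. \<Phi> (H i) x} \<or> (\<exists>x. \<Phi> (H i) x \<and> c x \<noteq> j)"
  proof (rule ccontr)
    let ?R = "\<lambda>i \<Phi> j. finite {x. \<Phi> (H i) x} \<or> (\<exists>x. \<Phi> (H i) x \<and> c x \<noteq> j)"
    assume "\<not> ?thesis"
    \<comment> \<open>If every \<open>H i\<close> failed, the counterexamples would together form
      one family of guesses, which some condition of the sequence has defeated.\<close>
    then have "\<exists>u. u \<in> P \<times> UNIV \<and> \<not> ?R i (fst u) (snd u)" if "i \<in> I" for i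
      using that by (metis SigmaI UNIV_I fst_conv snd_conv)
    then obtain t where t: "\<And>i. i \<in> I \<Longrightarrow> t i \<in> P \<times> UNIV"
      "\<And>i. i \<in> I \<Longrightarrow> \<not> ?R i (fst (t i)) (snd (t i))"
      by metis
    from t(1) have "restrict t I \<in> ?T" by (rule restrict_PiE_iff[THEN iffD2, rule_format])
    from p(3)[OF defeats_mem[OF this]] obtain n where "defeats c I (restrict t I) (p n)" by blast
    then obtain i where i: "i \<in> I" "\<forall>H. ?F n i \<subseteq> H \<and> H \<subseteq> ?F n i \<union> ?X n \<longrightarrow>
        finite {x. fst (restrict t I i) H x} \<or>
        (\<exists>x. fst (restrict t I i) H x \<and> c x \<noteq> snd (restrict t I i))"
      unfolding defeats_def split_beta by blast
    then have "?R i (fst (t i)) (snd (t i))"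
      using H_between[OF i(1), of n] unfolding restrict_apply'[OF i(1)] by blast
    then show False using t(2)[OF i(1)] by blast
  qed
  then show ?thesis using H_infinite H_homogeneous by blast
qed

theorem theorem1p3:
  fixes k l :: nat
  assumes "1 \<le> l" and "l < k"
  shows "\<exists>c :: nat \<Rightarrow> nat. (\<forall>x. c x < k) \<and>
    (\<forall>d. coloring UNIV 2 l d \<and> stable_coloring l d \<longrightarrow>
      (\<exists>H. infinite H \<and> homogeneous 2 d H \<and>
        \<not> (\<exists>Y. infinite Y \<and> homogeneous 1 (on_singletons c) Y \<and> computes H Y)))"
proof -
  \<comment> \<open>Only output 1 is recorded; by determinism, a program computing \<open>Y\<close>
    then enumerates exactly \<open>Y\<close>.\<close>
  define P where "P = range (\<lambda>p A x. evals A p [x] 1)"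
  have P: "countable P" "\<forall>\<Phi>\<in>P. finite_use \<Phi>"
    using evals_finite_use by (auto simp: P_def finite_use_def)
  obtain M where M: "countable M" "reservoirs P M" using ex_reservoirs[OF P(1)] by blast
  obtain c where c: "\<And>x. c x < k" "generic k M (labellings P M) c"
    using ex_generic[OF M(1) countable_labellings[OF P(1) M(1)], of k] assms by auto
  have "\<exists>H. infinite H \<and> homogeneous 2 d H \<and>
      \<not> (\<exists>Y. infinite Y \<and> homogeneous 1 (on_singletons c) Y \<and> computes H Y)"
    if d: "stable_coloring l d" for d
  proof -
    obtain H where H: "infinite H" "homogeneous 2 d H"
      "\<And>\<Phi> j. \<Phi> \<in> P \<Longrightarrow> finite {x. \<Phi> H x} \<or> (\<exists>x. \<Phi> H x \<and> c x \<noteq> j)"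
      using ex_homogeneous_not_enumerating[OF P M(2) c(2) assms(2) d] by blast
    have False if Y: "infinite Y" "homogeneous 1 (on_singletons c) Y" "computes H Y" for Y
    proof -
      obtain p where p: "\<And>x. evals H p [x] (if x \<in> Y then 1 else 0)"
        using Y(3) unfolding computes_def by blast
      have enum: "evals H p [x] 1 \<longleftrightarrow> x \<in> Y" for x
        using p[of x] evals_deterministic[of H p "[x]" 0 1] by (cases "x \<in> Y") auto
      obtain j where j: "\<forall>xs\<in>tuples Y 1. on_singletons c xs = j"
        using Y(2) unfolding homogeneous_def by blast
      have "c x = j" if "x \<in> Y" for x
        using j[rule_format, of "[x]"] that by (simp add: tuples_def on_singletons_def)
      then show False using H(3)[of "\<lambda>A x. evals A p [x] 1" j] Y(1) enum by (auto simp: P_def)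
    qed
    then show ?thesis using H(1,2) by blast
  qed
  then show ?thesis using c(1) by blast
qed

end
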